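(* Let $d\ge1$ and let $F(\theta)=\theta+\rho\bmod 1$ be a quasiperiodic map on $\mathbb{T}^d$, with trajectory $\theta_n=n\rho\bmod 1$. Let $\psi$ be one of the following: (a) a smooth map $\psi=\phi:\mathbb{T}^d\to S^1$; or (b) a smooth map $\psi=\gamma:\mathbb{T}^d\to\mathbb{R}^2$ together with a point $P\in\mathbb{R}^2\setminus\gamma(\mathbb{T}^d)$, which determine the angle map $\phi:\mathbb{T}^d\to S^1$. Let $K\ge1$ and assume that the delay map $\Theta=\Theta_K^\psi$ is an embedding of $\mathbb{T}^d$. Then there is $\delta_0>0$ such that for every $\delta\in(0,\delta_0)$ there is $N_0=N_0(\delta)$ such that for all $N\ge N_0$ the $\delta$-continuation procedure started from $m_0=0$ assigns an integer $m_n$ to every $n\in\{0,\dots,N-1\}$, so that $$\rho_\psi^N:=\frac1N\sum_{n=0}^{N-1}(\Delta_n+m_n)$$ is well defined; and $$\lim_{N\to\infty}\rho_\psi^N=\rho_\psi \pmod 1 .$$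
   Context: $\mathbb{T}^d=[0,1]^d\bmod1$ (coordinatewise), $S^1=\mathbb{T}^1$; smooth means $C^\infty$. The map $F(\theta)=\theta+\rho\bmod1$ is quasiperiodic if its orbits are dense in $\mathbb{T}^d$ and the coordinates of $\rho$ are irrational and rationally independent. Angle map in case (b): identifying $\mathbb{R}^2$ with $\mathbb{C}$, $\phi(\theta)\in S^1$ is defined by $e^{2\pi i\phi(\theta)}=(\gamma(\theta)-P)/\|\gamma(\theta)-P\|$. Angle differences: $\Delta(\theta)\in[0,1)$ is the representative of $\phi(\theta+\rho)-\phi(\theta)\bmod1$, and $\Delta_n:=\Delta(\theta_n)$. Rotation rate: write $\phi(\theta)=g(\theta)+a\cdot\theta\bmod1$ with $a\in\mathbb{Z}^d$ and $g:\mathbb{T}^d\to\mathbb{R}$ smooth, and $\hat\Delta(\theta)=a\cdot\rho+g(\theta+\rho)-g(\theta)$, a continuous real-valued lift of $\Delta$. Then $\rho_\psi:=\rho_\phi:=\left(\lim_{N\to\infty}\frac1N\sum_{n=0}^{N-1}\hat\Delta(\theta_n)\right)\bmod1$. Delay map: with $M_0=S^1$ in case (a) and $M_0=\mathbb{R}^2$ in case (b), $\Theta(\theta)=\Theta_K^\psi(\theta):=(\psi(\theta),\psi(F(\theta)),\dots,\psi(F^{K-1}(\theta)))\in M_0^K$, and $\Theta_n:=\Theta(\theta_n)$. An embedding is a diffeomorphism onto its image (in particular injective). Distances in $M_0^K\times\mathbb{R}$ are measured by the Euclidean norm $\|\cdot\|$ on $\mathbb{R}^{2K+1}$, where in case (a)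 $S^1$ is regarded as the unit circle in $\mathbb{R}^2$. $\delta$-continuation procedure (for given $\delta>0$ and $N$): set $m_0=0$ and let $\mathbb{A}=\{0\}$ be the set of indices whose integer has been assigned. Whenever there are $n_1\in\mathbb{A}$, $n_2\in\{0,\dots,N-1\}\setminus\mathbb{A}$ and an integer $k$ with $\|(\Theta_{n_1},\Delta_{n_1}+m_{n_1})-(\Theta_{n_2},\Delta_{n_2}+k)\|<\delta$, set $m_{n_2}:=k$ and add $n_2$ to $\mathbb{A}$; repeat as long as possible (choices being made in any order). *)

theory Defs
  imports "HOL-Analysis.Analysis"
begin

section \<open>Smoothness on open sets\<close>

primrec Ck_on :: "nat \<Rightarrow> 'a::euclidean_space set \<Rightarrow> ('a \<Rightarrow> 'b::real_normed_vector) \<Rightarrow> bool" where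
  "Ck_on 0 U f \<longleftrightarrow> continuous_on U f"
| "Ck_on (Suc n) U f \<longleftrightarrow>
     (\<forall>x\<in>U. f differentiable (at x)) \<and> (\<forall>v. Ck_on n U (\<lambda>x. frechet_derivative f (at x) v))"

definition smooth_on :: "'a::euclidean_space set \<Rightarrow> ('a \<Rightarrow> 'b::real_normed_vector) \<Rightarrow> bool" where
  "smooth_on U f \<longleftrightarrow> (\<forall>n. Ck_on n U f)"


section \<open>The torus\<close>

text \<open>
  The torus is the quotient of \<open>real ^ 'd\<close> by the integer lattice. Its points are given by
  representatives in \<open>real ^ 'd\<close>, and maps on it are lattice-periodic functions on \<open>real ^ 'd\<close>.
\<close>

definition int_lattice :: "(real ^ 'd) set" where
  "int_lattice = {k. \<forall>i. k $ i \<in> \<int>}"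

definition mod1 :: "real ^ 'd \<Rightarrow> real ^ 'd" where
  "mod1 x = (\<chi> i. frac (x $ i))"

definition rotation :: "real ^ 'd \<Rightarrow> real ^ 'd \<Rightarrow> real ^ 'd" where
  "rotation \<rho> \<theta> = mod1 (\<theta> + \<rho>)"

definition trajectory :: "real ^ 'd \<Rightarrow> nat \<Rightarrow> real ^ 'd" where
  "trajectory \<rho> n = mod1 (real n *\<^sub>R \<rho>)"

text \<open>A subset of the torus is dense iff its preimage in \<open>real ^ 'd\<close> is dense.\<close>

definition torus_dense :: "(real ^ 'd) set \<Rightarrow> bool" where
  "torus_dense S \<longleftrightarrow> closure {x + k | x k. x \<in> S \<and> k \<in> int_lattice} = UNIV"

definition quasiperiodic :: "real ^ 'd \<Rightarrow> bool" where
  "quasiperiodic \<rho> \<longleftrightarrow>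
     (\<forall>\<theta>. torus_dense (range (\<lambda>n. (rotation \<rho> ^^ n) \<theta>))) \<and>
     (\<forall>i. \<rho> $ i \<notin> \<rat>) \<and>
     (\<forall>q :: 'd \<Rightarrow> rat. (\<Sum>i\<in>UNIV. of_rat (q i) * \<rho> $ i) = 0 \<longrightarrow> (\<forall>i. q i = 0))"

definition torus_smooth :: "(real ^ 'd \<Rightarrow> 'b::real_normed_vector) \<Rightarrow> bool" where
  "torus_smooth f \<longleftrightarrow> smooth_on UNIV f \<and> (\<forall>\<theta>. \<forall>k\<in>int_lattice. f (\<theta> + k) = f \<theta>)"

text \<open>
  A diffeomorphism onto the image. As usual for maps on arbitrary subsets of a Euclidean space,
  the inverse (from the image to the torus) is smooth if near each point of the image it is the
  restriction of a smooth map on an open set of the ambient space. That map takes its values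
  in \<open>real ^ 'd\<close>, read modulo the lattice.
\<close>

definition torus_embedding :: "(real ^ 'd \<Rightarrow> 'b::euclidean_space) \<Rightarrow> bool" where
  "torus_embedding f \<longleftrightarrow>
     torus_smooth f \<and>
     (\<forall>x y. f x = f y \<longrightarrow> x - y \<in> int_lattice) \<and>
     (\<forall>x. \<exists>U (G :: 'b \<Rightarrow> real ^ 'd). open U \<and> f x \<in> U \<and> smooth_on U G \<and>
        (\<forall>y. f y \<in> U \<longrightarrow> G (f y) - y \<in> int_lattice))"


section \<open>Angle maps\<close>

text \<open>
  A map \<open>\<phi>\<close> from the torus to the circle (the reals modulo 1) is given by real representatives
  of its values, which may jump by integers. The circle is identified with the unit circle in the
  complex plane by \<open>t \<mapsto> cis (2 * pi * t)\<close>; periodicity and smoothness refer to that composition.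
\<close>

definition unit_circle_map :: "(real ^ 'd \<Rightarrow> real) \<Rightarrow> real ^ 'd \<Rightarrow> complex" where
  "unit_circle_map \<phi> \<theta> = cis (2 * pi * \<phi> \<theta>)"

definition is_angle_map :: "(real ^ 'd \<Rightarrow> complex) \<Rightarrow> complex \<Rightarrow> (real ^ 'd \<Rightarrow> real) \<Rightarrow> bool" where
  "is_angle_map \<gamma> P \<phi> \<longleftrightarrow>
     (\<forall>\<theta>. exp (2 * of_real pi * \<i> * of_real (\<phi> \<theta>)) = (\<gamma> \<theta> - P) / of_real (norm (\<gamma> \<theta> - P)))"

definition angle_diff :: "real ^ 'd \<Rightarrow> (real ^ 'd \<Rightarrow> real) \<Rightarrow> real ^ 'd \<Rightarrow> real" where
  "angle_diff \<rho> \<phi> \<theta> = frac (\<phi> (\<theta> + \<rho>) - \<phi> \<theta>)"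

definition angle_decomposition ::
    "(real ^ 'd \<Rightarrow> real) \<Rightarrow> real ^ 'd \<Rightarrow> (real ^ 'd \<Rightarrow> real) \<Rightarrow> bool" where
  "angle_decomposition \<phi> a g \<longleftrightarrow>
     a \<in> int_lattice \<and> torus_smooth g \<and> (\<forall>\<theta>. \<phi> \<theta> - (g \<theta> + a \<bullet> \<theta>) \<in> \<int>)"

definition angle_diff_lift ::
    "real ^ 'd \<Rightarrow> real ^ 'd \<Rightarrow> (real ^ 'd \<Rightarrow> real) \<Rightarrow> real ^ 'd \<Rightarrow> real" where
  "angle_diff_lift \<rho> a g \<theta> = a \<bullet> \<rho> + g (\<theta> + \<rho>) - g \<theta>"

definition rotation_rate :: "real ^ 'd \<Rightarrow> (real ^ 'd \<Rightarrow> real) \<Rightarrow> real" where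
  "rotation_rate \<rho> \<phi> =
     (THE r. \<exists>a g L. angle_decomposition \<phi> a g \<and>
        (\<lambda>N. (\<Sum>n<N. angle_diff_lift \<rho> a g (trajectory \<rho> n)) / real N) \<longlonglongrightarrow> L \<and>
        r = frac L)"


section \<open>Delay maps and continuation\<close>

text \<open>
  The delay coordinates are indexed by a finite linearly ordered type, whose cardinality is the
  number of delays; \<open>card {j. j < i}\<close> is the position of \<open>i\<close>, counted from 0.
\<close>

definition delay_map ::
    "real ^ 'd \<Rightarrow> (real ^ 'd \<Rightarrow> complex) \<Rightarrow> real ^ 'd \<Rightarrow> complex ^ 'k::{finite,linorder}" where
  "delay_map \<rho> \<psi> \<theta> = (\<chi> i. \<psi> ((rotation \<rho> ^^ card {j. j < i}) \<theta>))"

text \<open>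
  \<open>T n\<close> and \<open>D n\<close> are the delay vector and the angle difference at time \<open>n\<close>. A state is the finite
  map of the integers assigned so far. The norm on the product type is the Euclidean one.
\<close>

definition continuation_step ::
    "(nat \<Rightarrow> 'a::real_normed_vector) \<Rightarrow> (nat \<Rightarrow> real) \<Rightarrow> real \<Rightarrow> nat \<Rightarrow>
     (nat \<rightharpoonup> int) \<Rightarrow> (nat \<rightharpoonup> int) \<Rightarrow> bool" where
  "continuation_step T D \<delta> N m m' \<longleftrightarrow>
     (\<exists>n1 n2 k. n1 \<in> dom m \<and> n2 \<in> {..<N} - dom m \<and>
        norm ((T n1, D n1 + of_int (the (m n1))) - (T n2, D n2 + of_int k)) < \<delta> \<and>
        m' = m(n2 \<mapsto> k))"

inductive continuation_state ::
    "(nat \<Rightarrow> 'a::real_normed_vector) \<Rightarrow> (nat \<Rightarrow> real) \<Rightarrow> real \<Rightarrow> nat \<Rightarrow> (nat \<rightharpoonup> int) \<Rightarrow> bool"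
  for T D \<delta> N where
  start: "continuation_state T D \<delta> N [0 \<mapsto> 0]"
| step: "continuation_state T D \<delta> N m \<Longrightarrow> continuation_step T D \<delta> N m m' \<Longrightarrow>
    continuation_state T D \<delta> N m'"

definition continuation_result ::
    "(nat \<Rightarrow> 'a::real_normed_vector) \<Rightarrow> (nat \<Rightarrow> real) \<Rightarrow> real \<Rightarrow> nat \<Rightarrow> (nat \<rightharpoonup> int) \<Rightarrow> bool" where
  "continuation_result T D \<delta> N m \<longleftrightarrow>
     continuation_state T D \<delta> N m \<and> (\<nexists>m'. continuation_step T D \<delta> N m m')"

text \<open>The procedure always terminates, so statements about all its results are not vacuous.\<close>

lemma continuation_state_dom:
  "continuation_state T D \<delta> N m \<Longrightarrow> dom m \<subseteq> insert 0 {..<N}"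
  by (induction rule: continuation_state.induct) (force simp: continuation_step_def)+

lemma continuation_result_exists: "\<exists>m. continuation_result T D \<delta> N m"
proof -
  let ?S = "continuation_state T D \<delta> N"
  have "\<forall>m. ?S m \<longrightarrow> card (dom m) < N + 2"
  proof (intro allI impI)
    fix m assume "?S m"
    then have "card (dom m) \<le> card (insert 0 {..<N})"
      by (intro card_mono continuation_state_dom) auto
    also have "\<dots> \<le> Suc (card {..<N})"
      by (rule card_insert_le_m1) auto
    finally show "card (dom m) < N + 2" by simp
  qed
  then obtain m where m: "?S m" and max: "\<And>m'. ?S m' \<Longrightarrow> card (dom m') \<le> card (dom m)"
    using ex_has_greatest_nat[of ?S "[0 \<mapsto> 0]" "\<lambda>m. card (dom m)" "N + 2"]
      continuation_state.start[of T D \<delta> N] by auto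
  have "False" if s: "continuation_step T D \<delta> N m m'" for m'
  proof -
    have fin: "finite (dom m)"
      using continuation_state_dom[OF m] finite_subset by blast
    obtain n2 k where "n2 \<notin> dom m" "m' = m(n2 \<mapsto> k)"
      using s unfolding continuation_step_def by blast
    then have "card (dom m') = Suc (card (dom m))"
      using card_insert_disjoint[OF fin] by (simp only: dom_fun_upd option.simps if_False)
    then show False
      using max[OF continuation_state.step[OF m s]] by simp
  qed
  then show ?thesis
    using m by (auto simp: continuation_result_def)
qed

end

theory Submission
  imports Defs
begin

text \<open>
  Both cases give a smooth nowhere vanishing periodic map \<open>\<psi> - P\<close> to the plane (with \<open>P = 0\<close> in
  case (a)), whose continuous logarithm splits the angle map into a linear and a periodic part. The
  resulting lift \<open>u\<close> of the angle differences is continuous and periodic, and its averages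
  telescope to \<open>a \<bullet> \<rho>\<close>. Since the delay map is injective on the compact torus, nearby delay
  vectors force nearby values of \<open>u\<close>; hence every assignment made by the continuation stays
  on one integer translate of \<open>u\<close>. It cannot stop early: a long piece of the trajectory is a fine
  net in a connected space, so some assigned point is always close to an unassigned one.
\<close>

section \<open>Calculus of smooth maps\<close>

text \<open>On an open set the derivative at a point depends only on values inside the set, so
  agreement on \<open>U\<close> passes to all directional derivatives.\<close>

lemma Ck_on_cong:
  assumes "open U" "Ck_on n U f" "\<And>x. x \<in> U \<Longrightarrow> f x = g x"
  shows "Ck_on n U g"
  using assms(2,3)
proof (induction n arbitrary: f g)
  case 0
  then show ?case
    using continuous_on_eq[of U f g] by simp
next
  case (Suc n)
  have der: "(g has_derivative frechet_derivative f (at x)) (at x)" if "x \<in> U" for x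
    by (rule has_derivative_transform_within_open[OF _ assms(1) that Suc.prems(2)])
      (use Suc.prems(1) that in \<open>auto simp: frechet_derivative_works[symmetric]\<close>)
  have eq: "frechet_derivative f (at x) = frechet_derivative g (at x)" if "x \<in> U" for x
    by (rule frechet_derivative_at[OF der[OF that]])
  have "Ck_on n U (\<lambda>x. frechet_derivative g (at x) v)" for v
    by (rule Suc.IH[OF _ arg_cong2[OF eq refl, of _ "\<lambda>F. F"]])
      (use Suc.prems(1) in auto)
  then show ?case
    using der by (auto simp: differentiable_def)
qed

text \<open>Uniqueness of derivatives lets an explicit formula replace the choice operator
  \<open>frechet_derivative\<close>; the closure properties below rest on this rule.\<close>

lemma Ck_on_SucI:
  assumes "open U" "\<And>x. x \<in> U \<Longrightarrow> (f has_derivative f' x) (at x)"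
    and "\<And>v. Ck_on n U (\<lambda>x. f' x v)"
  shows "Ck_on (Suc n) U f"
proof -
  have "f' x = frechet_derivative f (at x)" if "x \<in> U" for x
    by (rule frechet_derivative_at[OF assms(2)[OF that]])
  then have "Ck_on n U (\<lambda>x. frechet_derivative f (at x) v)" for v
    by (intro Ck_on_cong[OF assms(1) assms(3)]) simp
  then show ?thesis
    using assms(2) by (auto simp: differentiable_def)
qed

lemma Ck_on_SucD:
  assumes "Ck_on (Suc n) U f" "x \<in> U"
  shows "(f has_derivative frechet_derivative f (at x)) (at x)"
  using assms by (simp add: frechet_derivative_works)

lemma Ck_on_Suc_imp: "Ck_on (Suc n) U f \<Longrightarrow> Ck_on n U f"
proof (induction n arbitrary: f)
  case 0
  then show ?case
    by (auto intro!: continuous_at_imp_continuous_on differentiable_imp_continuous_within)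
next
  case (Suc n)
  from Suc.prems show ?case
    by (subst Ck_on.simps(2), subst (asm) Ck_on.simps(2)) (blast intro: Suc.IH)
qed

lemma Ck_on_const: "open U \<Longrightarrow> Ck_on n U (\<lambda>x. c)"
proof (induction n arbitrary: c)
  case (Suc n)
  then show ?case
    by (intro Ck_on_SucI[where f' = "\<lambda>x v. 0"]) auto
qed simp

lemma Ck_on_bounded_linear:
  assumes "open U" "bounded_linear L"
  shows "Ck_on n U f \<Longrightarrow> Ck_on n U (\<lambda>x. L (f x))"
proof (induction n arbitrary: f)
  case 0
  then show ?case
    using bounded_linear.continuous_on[OF assms(2)] by simp
next
  case (Suc n)
  show ?case
    using Suc.IH Suc.prems
    by (intro Ck_on_SucI[where f' = "\<lambda>x v. L (frechet_derivative f (at x) v)"] assms(1)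
        bounded_linear.has_derivative[OF assms(2)] Ck_on_SucD) auto
qed

lemma Ck_on_linear:
  assumes "open U" "bounded_linear L"
  shows "Ck_on n U L"
proof (cases n)
  case 0
  then show ?thesis
    using bounded_linear.continuous_on[OF assms(2) continuous_on_id] by simp
next
  case (Suc n')
  show ?thesis
    unfolding Suc
    by (rule Ck_on_SucI[OF assms(1) bounded_linear_imp_has_derivative[OF assms(2)]])
      (rule Ck_on_const[OF assms(1)])
qed

lemma Ck_on_diff:
  assumes "open U"
  shows "Ck_on n U f \<Longrightarrow> Ck_on n U g \<Longrightarrow> Ck_on n U (\<lambda>x. f x - g x)"
proof (induction n arbitrary: f g)
  case 0
  then show ?case
    by (simp add: continuous_on_diff)
next
  case (Suc n)
  show ?case
    by (rule Ck_on_SucI[OF assms has_derivative_diff[OF Ck_on_SucD Ck_on_SucD]])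
      (use Suc in auto)
qed

lemma Ck_on_add:
  assumes "open U" "Ck_on n U f" "Ck_on n U g"
  shows "Ck_on n U (\<lambda>x. f x + g x)"
  \<comment> \<open>The sum is written as \<open>f - (0 - g)\<close>, which reduces it to
    differences.\<close>
  using Ck_on_diff[OF assms(1,2) Ck_on_diff[OF assms(1) Ck_on_const[OF assms(1), where c = 0] assms(3)]]
  by simp

lemma Ck_on_mult:
  fixes f g :: "'a::euclidean_space \<Rightarrow> 'b::real_normed_algebra"
  assumes "open U"
  shows "Ck_on n U f \<Longrightarrow> Ck_on n U g \<Longrightarrow> Ck_on n U (\<lambda>x. f x * g x)"
proof (induction n arbitrary: f g)
  case 0
  then show ?case
    by (simp add: continuous_on_mult)
next
  case (Suc n)
  \<comment> \<open>The product rule keeps one factor undifferentiated, so \<open>f\<close> and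
    \<open>g\<close> themselves are required at the lower order \<open>n\<close>.\<close>
  have "Ck_on n U f" "Ck_on n U g"
    using Suc.prems Ck_on_Suc_imp by blast+
  then have "Ck_on n U (\<lambda>x. f x * frechet_derivative g (at x) v + frechet_derivative f (at x) v * g x)" for v
    using Suc.IH Suc.prems by (intro Ck_on_add assms) auto
  then show ?case
    by (intro Ck_on_SucI[OF assms has_derivative_mult[OF Ck_on_SucD[OF Suc.prems(1)]
          Ck_on_SucD[OF Suc.prems(2)]]])
qed

lemma Ck_on_inverse:
  fixes f :: "'a::euclidean_space \<Rightarrow> 'b::real_normed_field"
  assumes "open U" "\<And>x. x \<in> U \<Longrightarrow> f x \<noteq> 0"
  shows "Ck_on n U f \<Longrightarrow> Ck_on n U (\<lambda>x. inverse (f x))"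
proof (induction n)
  case 0
  then show ?case
    using assms by (simp add: continuous_on_inverse)
next
  case (Suc n)
  have inv: "Ck_on n U (\<lambda>x. inverse (f x))"
    using Suc Ck_on_Suc_imp by blast
  show ?case
  proof (rule Ck_on_SucI[OF assms(1)])
    \<comment> \<open>The derivative contains the inverse of the same \<open>f\<close>, which
      \<open>inv\<close> controls at order \<open>n\<close>. The leading \<open>0 -\<close> stands
      for a unary minus so that \<open>Ck_on_diff\<close> applies.\<close>
    show "((\<lambda>x. inverse (f x)) has_derivative
        (\<lambda>v. 0 - inverse (f x) * frechet_derivative f (at x) v * inverse (f x))) (at x)"
      if "x \<in> U" for x
      using Deriv.has_derivative_inverse[OF assms(2)[OF that] Ck_on_SucD[OF Suc.prems that]]
      by simp
    show "Ck_on n U (\<lambda>x. 0 - inverse (f x) * frechet_derivative f (at x) v * inverse (f x))" for v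
      using Suc.prems
      by (intro Ck_on_diff Ck_on_mult Ck_on_const inv assms(1)) auto
  qed
qed

text \<open>By continuity \<open>h\<close> moves by less than \<open>pi\<close> near
  \<open>x\<close>, so there \<open>h y = h x + Ln (w y * inverse (w x))\<close>. At
  \<open>x\<close> the argument of \<open>Ln\<close> is 1, away from the branch cut wherever
  \<open>w x\<close> itself lies.\<close>

lemma has_derivative_continuous_log:
  fixes w h :: "'a::real_normed_vector \<Rightarrow> complex"
  assumes "open U" "x \<in> U" "continuous_on U h" "\<And>y. y \<in> U \<Longrightarrow> w y = exp (h y)"
    and w': "(w has_derivative w') (at x)"
  shows "(h has_derivative (\<lambda>v. w' v * inverse (w x))) (at x)"
proof -
  have "(h \<longlongrightarrow> h x) (at x)"
    using assms(3,2) by (simp add: continuous_on_eq_continuous_at[OF assms(1)] isContD)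
  then have "eventually (\<lambda>y. dist (h y) (h x) < pi) (at x)"
    by (rule tendstoD) simp
  then have ev: "eventually (\<lambda>y. h x + Ln (w y * inverse (w x)) = h y) (at x)"
    using eventually_at_in_open'[OF assms(1,2)]
  proof eventually_elim
    case (elim y)
    then have "\<bar>Im (h y - h x)\<bar> < pi"
      using abs_Im_le_cmod[of "h y - h x"] by (simp add: dist_norm)
    then show ?case
      using assms(2,4) elim Ln_exp[of "h y - h x"] by (simp add: exp_diff divide_inverse)
  qed
  have [simp]: "w x \<noteq> 0"
    using assms(2,4) by simp
  have Ln: "(Ln has_derivative times 1) (at (w x * inverse (w x)))"
    using has_field_derivative_Ln[of 1] by (simp add: has_field_derivative_def)
  have "((\<lambda>y. w y * inverse (w x)) has_derivative (\<lambda>v. w' v * inverse (w x))) (at x)"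
    by (intro has_derivative_mult_left w')
  from has_derivative_compose[OF this Ln]
  have "((\<lambda>y. h x + Ln (w y * inverse (w x))) has_derivative (\<lambda>v. w' v * inverse (w x))) (at x)"
    by (auto intro!: derivative_eq_intros)
  then show ?thesis
    by (rule has_derivative_transform_eventually[OF _ ev]) (simp_all)
qed

text \<open>The derivative of \<open>h\<close> is the logarithmic derivative of \<open>w\<close> and
  does not involve \<open>h\<close>, so a single differentiation replaces an induction on
  \<open>n\<close>.\<close>

lemma Ck_on_continuous_log:
  fixes w h :: "'a::euclidean_space \<Rightarrow> complex"
  assumes "open U" "continuous_on U h" "\<And>y. y \<in> U \<Longrightarrow> w y = exp (h y)" "Ck_on n U w"
  shows "Ck_on n U h"
proof (cases n)
  case 0
  then show ?thesis
    using assms by simp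
next
  case (Suc n')
  show ?thesis
    unfolding Suc
  proof (rule Ck_on_SucI[OF assms(1)])
    show "(h has_derivative (\<lambda>v. frechet_derivative w (at x) v * inverse (w x))) (at x)"
      if "x \<in> U" for x
      using has_derivative_continuous_log[OF assms(1) that assms(2,3)] Ck_on_SucD that assms(4) Suc
      by blast
    show "Ck_on n' U (\<lambda>x. frechet_derivative w (at x) v * inverse (w x))" for v
      using assms(4) Ck_on_Suc_imp[of n' U w] unfolding Suc
      by (intro Ck_on_mult Ck_on_inverse assms(1)) (auto simp: assms(3))
  qed
qed

section \<open>Periodic functions\<close>

lemma int_lattice_0: "0 \<in> int_lattice"
  and int_lattice_add: "k \<in> int_lattice \<Longrightarrow> l \<in> int_lattice \<Longrightarrow> k + l \<in> int_lattice"
  and int_lattice_diff: "k \<in> int_lattice \<Longrightarrow> l \<in> int_lattice \<Longrightarrow> k - l \<in> int_lattice"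
  and int_lattice_minus: "k \<in> int_lattice \<Longrightarrow> - k \<in> int_lattice"
  and int_lattice_axis: "axis i 1 \<in> int_lattice"
  by (auto simp: int_lattice_def axis_def)

lemma mod1_diff_in_int_lattice: "mod1 x - x \<in> int_lattice"
  by (simp add: int_lattice_def mod1_def frac_def)

lemma frac_eq_if_diff_Ints: "x - y \<in> \<int> \<Longrightarrow> frac x = frac y"
  for x y :: real
proof -
  assume "x - y \<in> \<int>"
  then obtain m where "x - y = of_int m"
    by (elim Ints_cases)
  then have "x = y + of_int m"
    by simp
  then show "frac x = frac y"
    by (simp add: frac_def)
qed

lemma mod1_eqI: "x - y \<in> int_lattice \<Longrightarrow> mod1 x = mod1 y"
  by (simp add: int_lattice_def mod1_def vec_eq_iff frac_eq_if_diff_Ints)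

lemma mod1_in_cbox: "mod1 x \<in> cbox 0 1"
  by (simp add: mod1_def mem_box_cart frac_ge_0 less_imp_le[OF frac_lt_1])

text \<open>Periodicity separated from smoothness, for maps such as the lift of the angle
  differences that are handled merely as continuous.\<close>

definition lattice_periodic :: "(real ^ 'd \<Rightarrow> 'b) \<Rightarrow> bool" where
  "lattice_periodic f \<longleftrightarrow> (\<forall>\<theta>. \<forall>k\<in>int_lattice. f (\<theta> + k) = f \<theta>)"

lemma lattice_periodicD:
  "lattice_periodic f \<Longrightarrow> x - y \<in> int_lattice \<Longrightarrow> f x = f y"
  unfolding lattice_periodic_def by (metis add.commute diff_add_cancel)

lemma lattice_periodic_mod1: "lattice_periodic f \<Longrightarrow> f (mod1 x) = f x"
  by (rule lattice_periodicD[OF _ mod1_diff_in_int_lattice])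

lemma torus_smoothD:
  assumes "torus_smooth f"
  shows "Ck_on n UNIV f" "continuous_on UNIV f" "lattice_periodic f"
  using assms Ck_on.simps(1) unfolding torus_smooth_def smooth_on_def lattice_periodic_def by blast+

lemma periodic_bounded:
  fixes f :: "real ^ 'd \<Rightarrow> 'b::real_normed_vector"
  assumes "continuous_on UNIV f" "lattice_periodic f"
  obtains B where "\<And>x. norm (f x) \<le> B"
proof -
  have "compact (f ` cbox 0 1)"
    using assms(1) by (intro compact_continuous_image) (auto intro: continuous_on_subset)
  then obtain B where "\<And>x. x \<in> cbox 0 1 \<Longrightarrow> norm (f x) \<le> B"
    by (metis compact_imp_bounded bounded_iff imageI)
  then show ?thesis
    using that[of B] mod1_in_cbox lattice_periodic_mod1[OF assms(2)] by metis
qed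

lemma periodic_uniformly_continuous:
  fixes f :: "real ^ 'd \<Rightarrow> 'b::real_normed_vector"
  assumes "continuous_on UNIV f" "lattice_periodic f" "e > 0"
  obtains \<eta> where "\<eta> > 0" "\<And>x y. dist x y < \<eta> \<Longrightarrow> dist (f x) (f y) < e"
proof -
  \<comment> \<open>\<open>mod1\<close> jumps at the boundary of the cube, so reducing
    \<open>x\<close> and \<open>y\<close> separately could tear them apart. Instead \<open>y\<close>
    is moved by the lattice vector that reduces \<open>x\<close>, and the cube is thickened by a
    unit ball to contain the result.\<close>
  define C :: "(real ^ 'd) set" where "C = {x + y | x y. x \<in> cbox 0 1 \<and> y \<in> cball 0 1}"
  have "compact C"
    unfolding C_def by (intro compact_sums compact_cbox compact_cball)
  then have "uniformly_continuous_on C f"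
    using assms(1) by (intro compact_uniformly_continuous) (auto intro: continuous_on_subset)
  then obtain \<eta> where \<eta>: "\<eta> > 0"
    "\<And>x y. x \<in> C \<Longrightarrow> y \<in> C \<Longrightarrow> dist x y < \<eta> \<Longrightarrow> dist (f x) (f y) < e"
    using assms(3) unfolding uniformly_continuous_on_def by metis
  have "dist (f x) (f y) < e" if "dist x y < min \<eta> 1" for x y
  proof -
    have C: "mod1 x + z \<in> C" if "norm z \<le> 1" for z
      unfolding C_def using mod1_in_cbox that by (intro CollectI exI[of _ "mod1 x"] exI[of _ z]) simp
    have "mod1 x \<in> C"
      using C[of 0] by simp
    moreover have "mod1 x + (y - x) \<in> C"
      using that by (intro C) (simp add: dist_norm norm_minus_commute)
    moreover have "dist (mod1 x) (mod1 x + (y - x)) < \<eta>"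
      using that by (simp add: dist_norm norm_minus_commute)
    ultimately have "dist (f (mod1 x)) (f (mod1 x + (y - x))) < e"
      using \<eta>(2) by simp
    moreover have "f (mod1 x + (y - x)) = f y"
      using mod1_diff_in_int_lattice[of x] by (intro lattice_periodicD[OF assms(2)]) simp
    ultimately show ?thesis
      using lattice_periodic_mod1[OF assms(2)] by metis
  qed
  then show ?thesis
    using that[of "min \<eta> 1"] \<eta>(1) by simp
qed

section \<open>Integer-valued functions and the periods of a lift\<close>

lemma continuous_Ints_valued_constant:
  fixes f :: "'a::real_normed_vector \<Rightarrow> real"
  assumes "continuous_on UNIV f" "\<And>x. f x \<in> \<int>"
  shows "f x = f y"
proof -
  have "f constant_on UNIV"
  proof (rule continuous_discrete_range_constant[OF connected_UNIV assms(1)])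
    fix x
    have "1 \<le> norm (f y - f x)" if "f y \<noteq> f x" for y
      using Ints_nonzero_abs_ge1[of "f y - f x"] assms(2) that by simp
    then show "\<exists>e>0. \<forall>y. y \<in> UNIV \<and> f y \<noteq> f x \<longrightarrow> e \<le> norm (f y - f x)"
      by (intro exI[of _ 1]) simp
  qed
  then show ?thesis
    unfolding constant_on_def by auto
qed

text \<open>The coordinates of \<open>k\<close> are integers, so additivity extends from the
  standard basis to integer multiples and then to their sums.\<close>

lemma additive_on_int_lattice:
  fixes c :: "real ^ 'd \<Rightarrow> real"
  assumes add: "\<And>k l. k \<in> int_lattice \<Longrightarrow> l \<in> int_lattice \<Longrightarrow> c (k + l) = c k + c l"
    and k: "k \<in> int_lattice"
  shows "c k = (\<chi> i. c (axis i 1)) \<bullet> k"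
proof -
  have c0: "c 0 = 0"
    using add[OF int_lattice_0 int_lattice_0] by simp
  have nat: "of_nat n *\<^sub>R l \<in> int_lattice \<and> c (of_nat n *\<^sub>R l) = of_nat n * c l"
    if "l \<in> int_lattice" for l and n :: nat
    by (induction n) (use that add int_lattice_add in \<open>auto simp: c0 int_lattice_0 scaleR_add_left algebra_simps\<close>)
  have minus: "c (- l) = - c l" if "l \<in> int_lattice" for l
    using add[OF that int_lattice_minus[OF that]] c0 by simp
  have int: "of_int n *\<^sub>R l \<in> int_lattice \<and> c (of_int n *\<^sub>R l) = of_int n * c l"
    if "l \<in> int_lattice" for l and n :: int
    by (cases n rule: int_cases2)
      (use nat[OF that] minus in \<open>auto simp: int_lattice_minus\<close>)
  have cterm: "(k $ i) *\<^sub>R axis i 1 \<in> int_lattice \<and> c ((k $ i) *\<^sub>R axis i 1) = k $ i * c (axis i 1)" for i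
  proof -
    have "k $ i \<in> \<int>"
      using k by (simp add: int_lattice_def)
    then show ?thesis
      using int[OF int_lattice_axis] by (metis Ints_cases)
  qed
  \<comment> \<open>Membership in the lattice is carried through the induction because additivity is
    available only there.\<close>
  have "(\<Sum>i\<in>S. (k $ i) *\<^sub>R axis i 1) \<in> int_lattice \<and>
      c (\<Sum>i\<in>S. (k $ i) *\<^sub>R axis i 1) = (\<Sum>i\<in>S. k $ i * c (axis i 1))" if "finite S" for S
    using that
  proof (induction S)
    case empty
    then show ?case
      by (simp add: c0 int_lattice_0)
  next
    case (insert i S)
    then show ?case
      using cterm[of i] by (simp add: add int_lattice_add)
  qed
  from this[of UNIV] have "c (\<Sum>i\<in>UNIV. (k $ i) *\<^sub>R axis i 1) = (\<Sum>i\<in>UNIV. k $ i * c (axis i 1))"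
    by simp
  moreover have "(\<Sum>i\<in>UNIV. (k $ i) *\<^sub>R axis i 1) = k"
    using basis_expansion[of k] by (simp add: scalar_mult_eq_scaleR)
  ultimately show ?thesis
    by (simp add: inner_vec_def mult.commute)
qed

text \<open>For fixed \<open>k\<close> the increment is continuous and integer-valued in
  \<open>\<theta>\<close>, hence constant. Independence of \<open>\<theta>\<close> makes it additive
  in \<open>k\<close>; the vector \<open>a\<close> collects the degrees along the coordinate
  circles.\<close>

lemma integer_periods:
  fixes p :: "real ^ 'd \<Rightarrow> real"
  assumes "continuous_on UNIV p" "\<And>\<theta> k. k \<in> int_lattice \<Longrightarrow> p (\<theta> + k) - p \<theta> \<in> \<int>"
  obtains a where "a \<in> int_lattice" "\<And>\<theta> k. k \<in> int_lattice \<Longrightarrow> p (\<theta> + k) - p \<theta> = a \<bullet> k"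
proof -
  define c where "c k = p k - p 0" for k
  have c: "p (\<theta> + k) - p \<theta> = c k" if "k \<in> int_lattice" for \<theta> k
  proof -
    have "continuous_on UNIV (\<lambda>\<theta>. p (\<theta> + k) - p \<theta>)"
      by (intro continuous_intros assms(1) continuous_on_compose2[OF assms(1)]) auto
    from continuous_Ints_valued_constant[OF this assms(2)[OF that], of \<theta> 0] show ?thesis
      by (simp add: c_def)
  qed
  have "c (k + l) = c k + c l" if "k \<in> int_lattice" "l \<in> int_lattice" for k l
    using c[OF that(2), of k] by (simp add: c_def)
  then have ck: "c k = (\<chi> i. c (axis i 1)) \<bullet> k" if "k \<in> int_lattice" for k
    by (rule additive_on_int_lattice) (use that in auto)
  have "(\<chi> i. c (axis i 1)) \<in> int_lattice"
    using assms(2)[OF int_lattice_axis, of 0] by (simp add: int_lattice_def c_def)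
  then show ?thesis
    using that[of "\<chi> i. c (axis i 1)"] c ck by simp
qed

section \<open>Lifting the angle\<close>

lemma exp_2pi_eq_imp_Ints:
  assumes "exp (2 * of_real pi * \<i> * of_real x) = exp (2 * of_real pi * \<i> * of_real y)"
  shows "x - y \<in> \<int>"
proof -
  obtain n :: int where
    "2 * of_real pi * \<i> * of_real x = 2 * of_real pi * \<i> * of_real y + (of_int (2 * n) * pi) * \<i>"
    using assms unfolding exp_eq by blast
  then have "Im (2 * of_real pi * \<i> * of_real x) =
      Im (2 * of_real pi * \<i> * of_real y + (of_int (2 * n) * pi) * \<i>)"
    by (rule arg_cong)
  then have "2 * pi * (x - y) = 2 * pi * of_int n"
    by (simp add: algebra_simps)
  then show ?thesis
    by simp
qed

text \<open>Since \<open>real ^ 'd\<close> is contractible, the nonvanishing map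
  \<open>\<psi> - P\<close> has a continuous logarithm \<open>h\<close>. Its imaginary part over
  \<open>2 * pi\<close> is a smooth angle \<open>p\<close>, and removing the linear part given by
  its integer periods leaves a periodic \<open>g\<close>.\<close>

lemma angle_decomposition_exists:
  assumes \<psi>: "torus_smooth \<psi>" and P: "P \<notin> range \<psi>" and \<phi>: "is_angle_map \<psi> P \<phi>"
  obtains a g where "angle_decomposition \<phi> a g"
proof -
  define w where "w \<theta> = \<psi> \<theta> - P" for \<theta>
  have w0: "w \<theta> \<noteq> 0" for \<theta>
    using P by (auto simp: w_def)
  have Ck_w: "Ck_on n UNIV w" for n
    unfolding w_def by (intro Ck_on_diff Ck_on_const torus_smoothD(1) \<psi>) auto
  have "continuous_on UNIV w"
    using Ck_w[of 0] by simp
  moreover have "contractible (UNIV :: (real ^ 'd) set)"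
    by (intro convex_imp_contractible convex_UNIV)
  ultimately obtain h where h: "continuous_on UNIV h" "\<And>\<theta>. w \<theta> = exp (h \<theta>)"
    using continuous_logarithm_on_contractible[of UNIV w] w0 by auto
  define L :: "complex \<Rightarrow> real" where "L z = Im z / (2 * pi)" for z
  have L: "bounded_linear L"
    unfolding L_def by (intro bounded_linear_compose[OF bounded_linear_divide bounded_linear_Im])
  define p where "p \<theta> = L (h \<theta>)" for \<theta>
  have Ck_p: "Ck_on n UNIV p" for n
    unfolding p_def
    by (rule Ck_on_bounded_linear[OF open_UNIV L Ck_on_continuous_log[OF open_UNIV h Ck_w]])
  \<comment> \<open>Normalizing \<open>w\<close> removes the real part of \<open>h\<close>. The
    comparison goes through exponentials because \<open>\<phi>\<close> may jump by integers where
    \<open>p\<close> is continuous.\<close>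
  have \<phi>p: "\<phi> \<theta> - p \<theta> \<in> \<int>" for \<theta>
  proof (rule exp_2pi_eq_imp_Ints)
    have "exp (2 * of_real pi * \<i> * of_real (\<phi> \<theta>)) = w \<theta> / of_real (norm (w \<theta>))"
      using \<phi> unfolding is_angle_map_def w_def by blast
    also have "\<dots> = exp (h \<theta>) / of_real (exp (Re (h \<theta>)))"
      unfolding h(2) norm_exp_eq_Re ..
    also have "\<dots> = exp (h \<theta> - of_real (Re (h \<theta>)))"
      by (simp only: exp_diff exp_of_real)
    also have "h \<theta> - of_real (Re (h \<theta>)) = 2 * of_real pi * \<i> * of_real (p \<theta>)"
      by (simp add: complex_eq_iff p_def L_def)
    finally show "exp (2 * of_real pi * \<i> * of_real (\<phi> \<theta>)) = exp (2 * of_real pi * \<i> * of_real (p \<theta>))" .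
  qed
  have "p (\<theta> + k) - p \<theta> \<in> \<int>" if "k \<in> int_lattice" for \<theta> k
  proof -
    have "\<psi> (\<theta> + k) = \<psi> \<theta>"
      using torus_smoothD(3)[OF \<psi>] that by (simp add: lattice_periodic_def)
    then have "\<phi> (\<theta> + k) - \<phi> \<theta> \<in> \<int>"
      using \<phi> by (intro exp_2pi_eq_imp_Ints) (simp add: is_angle_map_def)
    then have "(\<phi> (\<theta> + k) - \<phi> \<theta>) - (\<phi> (\<theta> + k) - p (\<theta> + k)) + (\<phi> \<theta> - p \<theta>) \<in> \<int>"
      by (rule Ints_add[OF Ints_diff[OF _ \<phi>p] \<phi>p])
    then show ?thesis
      by simp
  qed
  moreover have "continuous_on UNIV p"
    using Ck_p[of 0] by simp
  ultimately obtain a where a: "a \<in> int_lattice"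
    "\<And>\<theta> k. k \<in> int_lattice \<Longrightarrow> p (\<theta> + k) - p \<theta> = a \<bullet> k"
    using integer_periods[of p] by blast
  define g where "g \<theta> = p \<theta> - a \<bullet> \<theta>" for \<theta>
  have "g (\<theta> + k) = g \<theta>" if "k \<in> int_lattice" for \<theta> k
    using a(2)[OF that, of \<theta>] by (simp add: g_def inner_add_right)
  moreover have "Ck_on n UNIV g" for n
    unfolding g_def by (intro Ck_on_diff Ck_p Ck_on_linear bounded_linear_inner_right) auto
  ultimately have "torus_smooth g"
    by (simp add: torus_smooth_def smooth_on_def)
  then have "angle_decomposition \<phi> a g"
    using a(1) \<phi>p by (simp add: angle_decomposition_def g_def)
  then show ?thesis
    by (rule that)
qed

text \<open>Two decompositions differ by a continuous integer-valued function, hence by a constant.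
  Comparing its values at 0 and at the unit vectors, where \<open>g\<close> and \<open>h\<close>
  repeat, gives \<open>a = b\<close>; the remaining constant cancels in the increments. This makes
  the definite description in \<open>rotation_rate\<close> meaningful.\<close>

lemma angle_diff_lift_unique:
  assumes "angle_decomposition \<phi> a g" "angle_decomposition \<phi> b h"
  shows "angle_diff_lift \<rho> a g = angle_diff_lift \<rho> b h"
proof -
  define f where "f \<theta> = (g \<theta> + a \<bullet> \<theta>) - (h \<theta> + b \<bullet> \<theta>)" for \<theta>
  have g: "torus_smooth g" and h: "torus_smooth h"
    using assms by (auto simp: angle_decomposition_def)
  have "(\<phi> \<theta> - (h \<theta> + b \<bullet> \<theta>)) - (\<phi> \<theta> - (g \<theta> + a \<bullet> \<theta>)) \<in> \<int>" for \<theta>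
    by (rule Ints_diff) (use assms in \<open>auto simp: angle_decomposition_def\<close>)
  then have "f \<theta> \<in> \<int>" for \<theta>
    by (simp add: f_def algebra_simps)
  moreover have "continuous_on UNIV f"
    unfolding f_def by (intro continuous_intros torus_smoothD(2) g h)
  ultimately have const: "f x = f y" for x y
    using continuous_Ints_valued_constant by blast
  have "a $ i = b $ i" for i
  proof -
    have "g (axis i 1) = g 0" "h (axis i 1) = h 0"
      using int_lattice_axis[of i] by (auto intro!: lattice_periodicD torus_smoothD(3) g h)
    then show ?thesis
      using const[of "axis i 1" 0] by (simp add: f_def inner_axis)
  qed
  then have "a = b"
    by (simp add: vec_eq_iff)
  then have "g x - h x = g y - h y" for x y
    using const[of x y] by (simp add: f_def)
  then have "g x - g y = h x - h y" for x y
    by (metis diff_diff_eq2 add_diff_eq diff_add_eq add.commute diff_eq_eq)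
  then show "angle_diff_lift \<rho> a g = angle_diff_lift \<rho> b h"
    unfolding angle_diff_lift_def \<open>a = b\<close> by (auto simp flip: add_diff_eq)
qed

lemma angle_diff_lift_continuous:
  "torus_smooth g \<Longrightarrow> continuous_on UNIV (angle_diff_lift \<rho> a g)"
  unfolding angle_diff_lift_def[abs_def]
  by (intro continuous_intros continuous_on_compose2[OF torus_smoothD(2), of g UNIV "\<lambda>\<theta>. \<theta> + \<rho>"]
      torus_smoothD(2)) auto

lemma angle_diff_lift_periodic:
  assumes "torus_smooth g"
  shows "lattice_periodic (angle_diff_lift \<rho> a g)"
proof -
  have "g (\<theta> + k + \<rho>) = g (\<theta> + \<rho>)" "g (\<theta> + k) = g \<theta>" if "k \<in> int_lattice" for \<theta> k
    using that by (auto intro!: lattice_periodicD torus_smoothD(3) assms)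
  then show ?thesis
    by (simp add: lattice_periodic_def angle_diff_lift_def)
qed

lemma angle_diff_minus_lift_in_Ints:
  assumes "angle_decomposition \<phi> a g"
  shows "angle_diff \<rho> \<phi> \<theta> - angle_diff_lift \<rho> a g \<theta> \<in> \<int>"
proof -
  have dec: "\<phi> \<theta> - (g \<theta> + a \<bullet> \<theta>) \<in> \<int>" for \<theta>
    using assms by (simp add: angle_decomposition_def)
  have "(\<phi> (\<theta> + \<rho>) - (g (\<theta> + \<rho>) + a \<bullet> (\<theta> + \<rho>))) - (\<phi> \<theta> - (g \<theta> + a \<bullet> \<theta>))
      - of_int \<lfloor>\<phi> (\<theta> + \<rho>) - \<phi> \<theta>\<rfloor> \<in> \<int>"
    by (rule Ints_diff[OF Ints_diff[OF dec dec] Ints_of_int])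
  then show ?thesis
    by (simp add: angle_diff_def angle_diff_lift_def frac_def inner_add_right algebra_simps)
qed

section \<open>Averages along the trajectory and the rotation rate\<close>

lemma trajectory_Suc: "trajectory \<rho> (Suc n) = mod1 (trajectory \<rho> n + \<rho>)"
  unfolding trajectory_def
  using int_lattice_minus[OF mod1_diff_in_int_lattice[of "real n *\<^sub>R \<rho>"]]
  by (intro mod1_eqI) (simp add: algebra_simps)

lemma trajectory_conv_funpow: "trajectory \<rho> n = (rotation \<rho> ^^ n) 0"
proof (induction n)
  case 0
  then show ?case
    by (simp add: trajectory_def mod1_def vec_eq_iff)
qed (simp add: trajectory_Suc rotation_def)

text \<open>Periodicity turns \<open>g\<close> at the rotated point into \<open>g\<close> at the
  next trajectory point, so the sum telescopes to a linear term plus a bounded remainder.\<close>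

lemma angle_diff_lift_average:
  assumes "torus_smooth g"
  shows "(\<lambda>N. (\<Sum>n<N. angle_diff_lift \<rho> a g (trajectory \<rho> n)) / real N) \<longlonglongrightarrow> a \<bullet> \<rho>"
proof -
  let ?t = "trajectory \<rho>"
  have "angle_diff_lift \<rho> a g (?t n) = a \<bullet> \<rho> + (g (?t (Suc n)) - g (?t n))" for n
    using lattice_periodic_mod1[OF torus_smoothD(3)[OF assms], of "?t n + \<rho>"]
    by (simp add: angle_diff_lift_def trajectory_Suc)
  then have sum: "(\<Sum>n<N. angle_diff_lift \<rho> a g (?t n)) = real N * (a \<bullet> \<rho>) + (g (?t N) - g (?t 0))" for N
    by (simp add: sum.distrib sum_lessThan_telescope[of "\<lambda>n. g (?t n)"])
  obtain B where B: "\<And>\<theta>. norm (g \<theta>) \<le> B"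
    using periodic_bounded[OF torus_smoothD(2,3)[OF assms]] by blast
  have "(\<lambda>N. (g (?t N) - g (?t 0)) / real N) \<longlonglongrightarrow> 0"
  proof (rule Lim_null_comparison)
    show "\<forall>\<^sub>F N in sequentially. norm ((g (?t N) - g (?t 0)) / real N) \<le> 2 * B / real N"
    proof (intro always_eventually allI)
      fix N
      have "norm (g (?t N) - g (?t 0)) \<le> 2 * B"
        using norm_triangle_ineq4[of "g (?t N)" "g (?t 0)"] B[of "?t N"] B[of "?t 0"] by linarith
      then show "norm ((g (?t N) - g (?t 0)) / real N) \<le> 2 * B / real N"
        by (simp add: divide_right_mono)
    qed
    show "(\<lambda>N. 2 * B / real N) \<longlonglongrightarrow> 0"
      by (rule lim_const_over_n)
  qed
  from tendsto_add[OF tendsto_const[of "a \<bullet> \<rho>"] this]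
  have "(\<lambda>N. a \<bullet> \<rho> + (g (?t N) - g (?t 0)) / real N) \<longlonglongrightarrow> a \<bullet> \<rho>"
    by simp
  moreover have "\<forall>\<^sub>F N in sequentially. a \<bullet> \<rho> + (g (?t N) - g (?t 0)) / real N =
      (\<Sum>n<N. angle_diff_lift \<rho> a g (?t n)) / real N"
    \<comment> \<open>The identity may fail at \<open>N = 0\<close>, where the quotients take the
      value 0 by convention.\<close>
    using eventually_gt_at_top[of 0] by eventually_elim (simp add: sum field_simps)
  ultimately show ?thesis
    by (rule Lim_transform_eventually)
qed

lemma rotation_rate_eq:
  assumes "angle_decomposition \<phi> a g"
  shows "rotation_rate \<rho> \<phi> = frac (a \<bullet> \<rho>)"
  unfolding rotation_rate_def
proof (rule the_equality)
  have g: "torus_smooth g"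
    using assms by (simp add: angle_decomposition_def)
  show "\<exists>a' g' L. angle_decomposition \<phi> a' g' \<and>
      (\<lambda>N. (\<Sum>n<N. angle_diff_lift \<rho> a' g' (trajectory \<rho> n)) / real N) \<longlonglongrightarrow> L \<and>
      frac (a \<bullet> \<rho>) = frac L"
    using assms angle_diff_lift_average[OF g] by blast
  fix r
  assume "\<exists>a' g' L. angle_decomposition \<phi> a' g' \<and>
      (\<lambda>N. (\<Sum>n<N. angle_diff_lift \<rho> a' g' (trajectory \<rho> n)) / real N) \<longlonglongrightarrow> L \<and> r = frac L"
  then show "r = frac (a \<bullet> \<rho>)"
    using angle_diff_lift_unique[OF assms] angle_diff_lift_average[OF g] LIMSEQ_unique
    by metis
qed

section \<open>Continuation along the trajectory\<close>

lemma trajectory_net: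
  fixes \<rho> :: "real ^ 'd"
  assumes "quasiperiodic \<rho>" "e > 0"
  obtains N where "N > 0" "\<And>x. \<exists>n<N. \<exists>k\<in>int_lattice. dist (trajectory \<rho> n + k) x < e"
proof -
  \<comment> \<open>Each \<open>B n\<close> contains all lattice translates of one ball, so
    compactness of the cube has to select only finitely many times, not lattice vectors.\<close>
  define B where "B n = (\<Union>k\<in>int_lattice. ball (trajectory \<rho> n + k) e)" for n
  let ?S = "{x + k | x k. x \<in> range (trajectory \<rho>) \<and> k \<in> int_lattice}"
  have "torus_dense (range (\<lambda>n. (rotation \<rho> ^^ n) 0))"
    using assms(1) by (simp add: quasiperiodic_def)
  then have closure: "closure ?S = UNIV"
    unfolding torus_dense_def trajectory_conv_funpow[symmetric] .
  have "x \<in> (\<Union>n. B n)" for x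
  proof -
    obtain y where "y \<in> ?S" "dist y x < e"
      using closure_approachable[of x ?S] closure assms(2) by blast
    then show ?thesis
      unfolding B_def by (auto simp: mem_ball)
  qed
  then have "cbox 0 1 \<subseteq> (\<Union>n. B n)"
    by blast
  moreover have "open (B n)" for n
    unfolding B_def by blast
  ultimately obtain C where C: "finite C" "cbox 0 1 \<subseteq> (\<Union>n\<in>C. B n)"
    using compactE_image[OF compact_cbox, of UNIV B] by (metis UNIV_I)
  then obtain N where N: "\<And>n. n \<in> C \<Longrightarrow> n < N"
    by (meson finite_nat_set_iff_bounded)
  have "\<exists>n<Suc N. \<exists>k\<in>int_lattice. dist (trajectory \<rho> n + k) x < e" for x
  proof -
    obtain n k where n: "n \<in> C" and k: "k \<in> int_lattice" "dist (trajectory \<rho> n + k) (mod1 x) < e"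
      using C(2) mod1_in_cbox[of x] unfolding B_def by fastforce
    have "trajectory \<rho> n + (k - (mod1 x - x)) - x = trajectory \<rho> n + k - mod1 x"
      by simp
    then have "dist (trajectory \<rho> n + (k - (mod1 x - x))) x < e"
      using k(2) by (simp only: dist_norm)
    moreover have "k - (mod1 x - x) \<in> int_lattice"
      by (intro int_lattice_diff k mod1_diff_in_int_lattice)
    ultimately show ?thesis
      using N[OF n] less_SucI by blast
  qed
  then show ?thesis
    using that[of "Suc N"] by blast
qed

text \<open>The balls around the points with indices in \<open>A\<close> and those around the remaining points form
  two open sets covering the connected space \<open>real ^ 'd\<close>, so they meet.\<close>

lemma net_adjacent:
  fixes t :: "nat \<Rightarrow> real ^ 'd"
  assumes net: "\<And>x. \<exists>n<N. \<exists>k\<in>int_lattice. dist (t n + k) x < e"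
    and A: "A \<subseteq> {..<N}" "A \<noteq> {}" "A \<noteq> {..<N}" and "e > 0"
  obtains i j k where "i \<in> A" "j \<in> {..<N} - A" "k \<in> int_lattice" "dist (t i) (t j + k) < 2 * e"
proof -
  define U where "U S = (\<Union>n\<in>S. \<Union>k\<in>int_lattice. ball (t n + k) e)" for S
  have "open (U S)" for S
    unfolding U_def by blast
  moreover have ne: "U S \<inter> UNIV \<noteq> {}" if "S \<noteq> {}" for S
    unfolding U_def using that int_lattice_0 \<open>e > 0\<close> by fastforce
  moreover have "UNIV \<subseteq> U A \<union> U ({..<N} - A)"
  proof
    fix x
    obtain n k where "n < N" "k \<in> int_lattice" "dist (t n + k) x < e"
      using net by blast
    then show "x \<in> U A \<union> U ({..<N} - A)"
      unfolding U_def by (cases "n \<in> A") auto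
  qed
  moreover have "{..<N} - A \<noteq> {}"
    using A by blast
  ultimately have "U A \<inter> U ({..<N} - A) \<inter> UNIV \<noteq> {}"
    using connectedD[OF connected_UNIV, of "U A" "U ({..<N} - A)"] A(2) by metis
  then obtain z where "z \<in> U A" "z \<in> U ({..<N} - A)"
    by blast
  then obtain i k j l where i: "i \<in> A" "k \<in> int_lattice" "dist (t i + k) z < e"
    and j: "j \<in> {..<N} - A" "l \<in> int_lattice" "dist (t j + l) z < e"
    unfolding U_def by auto
  have "dist (t i + k) (t j + l) < 2 * e"
    using dist_triangle2[of "t i + k" "t j + l" z] i(3) j(3) by simp
  \<comment> \<open>Translating both points by \<open>- k\<close> leaves the point with index
    \<open>i\<close> in place and puts the whole lattice shift on the other one.\<close>
  moreover have "t i + k - (t j + l) = t i - (t j + (l - k))"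
    by simp
  ultimately have "dist (t i) (t j + (l - k)) < 2 * e"
    by (simp only: dist_norm)
  then show ?thesis
    by (rule that[OF i(1) j(1) int_lattice_diff[OF j(2) i(2)]])
qed

text \<open>The pairs in the cube whose \<open>u\<close>-values differ by at least \<open>e\<close>
  form a compact set. Injectivity modulo the lattice keeps \<open>f x\<close> and \<open>f y\<close>
  distinct there, so their distance has a positive minimum, which serves as
  \<open>d\<close>.\<close>

lemma periodic_embedding_separates:
  fixes f :: "real ^ 'd \<Rightarrow> 'b::real_normed_vector" and u :: "real ^ 'd \<Rightarrow> real"
  assumes f: "continuous_on UNIV f" "lattice_periodic f" "\<And>x y. f x = f y \<Longrightarrow> x - y \<in> int_lattice"
    and u: "continuous_on UNIV u" "lattice_periodic u" and "e > 0"
  obtains d where "d > 0" "\<And>x y. norm (f x - f y) < d \<Longrightarrow> \<bar>u x - u y\<bar> < e"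
proof -
  define Q where "Q = (cbox 0 1 \<times> cbox 0 1) \<inter> {z. e \<le> \<bar>u (fst z) - u (snd z)\<bar>}"
  have Q: "d \<le> norm (f x - f y)"
    if "\<And>z. z \<in> Q \<Longrightarrow> d \<le> norm (f (fst z) - f (snd z))" "e \<le> \<bar>u x - u y\<bar>" for d x y
  proof -
    have "(mod1 x, mod1 y) \<in> Q"
      using that(2) mod1_in_cbox by (auto simp: Q_def lattice_periodic_mod1[OF u(2)])
    from that(1)[OF this] show ?thesis
      by (simp add: lattice_periodic_mod1[OF f(2)])
  qed
  have cont: "continuous_on UNIV (\<lambda>z. norm (f (fst z) - f (snd z)))"
    by (intro continuous_intros continuous_on_compose2[OF f(1)]) auto
  have "closed {z. e \<le> \<bar>u (fst z) - u (snd z)\<bar>}"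
    by (intro closed_Collect_le continuous_intros continuous_on_compose2[OF u(1)]) auto
  then have "compact Q"
    unfolding Q_def by (intro compact_Int_closed compact_Times compact_cbox)
  show ?thesis
  proof (cases "Q = {}")
    case True
    then have "\<bar>u x - u y\<bar> < e" for x y
      \<comment> \<open>With \<open>Q\<close> empty every number is a lower bound, even one
        exceeding the actual distance.\<close>
      using Q[of "norm (f x - f y) + 1" x y] by fastforce
    then show ?thesis
      using that[of 1] by simp
  next
    case False
    then obtain z where z: "z \<in> Q" "\<And>z'. z' \<in> Q \<Longrightarrow> norm (f (fst z) - f (snd z)) \<le> norm (f (fst z') - f (snd z'))"
      using continuous_attains_inf[OF \<open>compact Q\<close> _ continuous_on_subset[OF cont]] by auto
    have "u (fst z) \<noteq> u (snd z)"
      using z(1) \<open>e > 0\<close> by (auto simp: Q_def)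
    then have "f (fst z) \<noteq> f (snd z)"
      using f(3) lattice_periodicD[OF u(2)] by blast
    then have "norm (f (fst z) - f (snd z)) > 0"
      by simp
    then show ?thesis
      using that[of "norm (f (fst z) - f (snd z))"] Q[OF z(2)] by (meson linorder_not_less)
  qed
qed

text \<open>The continuation keeps \<open>D n + m n\<close> on a single integer translate of the lift \<open>E\<close>, because
  two such translates are at distance at least 1.\<close>

lemma continuation_state_follows_lift:
  assumes "continuation_state T D \<delta> N m" "\<delta> \<le> 1/2"
    and DE: "\<And>n. D n - E n \<in> \<int>"
    and close: "\<And>i j. norm (T i - T j) < \<delta> \<Longrightarrow> \<bar>E i - E j\<bar> < 1/2"
  shows "\<forall>n\<in>dom m. D n + of_int (the (m n)) = E n + (D 0 - E 0)"
  using assms(1)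
proof induction
  \<comment> \<open>The initial integer 0 at index 0 fixes the translate
    \<open>D 0 - E 0\<close>.\<close>
  case start
  show ?case
    by (auto split: if_splits)
next
  case (step m m')
  let ?c = "D 0 - E 0"
  from step.hyps(2) obtain i j k where i: "i \<in> dom m"
    and near: "norm ((T i, D i + of_int (the (m i))) - (T j, D j + of_int k)) < \<delta>"
    and m': "m' = m(j \<mapsto> k)"
    unfolding continuation_step_def by blast
  have Di: "D i + of_int (the (m i)) = E i + ?c"
    using step.IH i by blast
  have "norm (T i - T j) < \<delta>"
    using norm_fst_le[of "T i - T j"] near by (auto intro: le_less_trans)
  from close[OF this] have "\<bar>E i - E j\<bar> < 1/2" .
  moreover have "\<bar>E i + ?c - (D j + of_int k)\<bar> < 1/2"
  proof -
    have "norm (E i + ?c - (D j + of_int k)) < \<delta>"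
      using norm_snd_le[of "E i + ?c - (D j + of_int k)" "T i - T j"] near
      unfolding Di by (auto intro: le_less_trans)
    then show ?thesis
      using \<open>\<delta> \<le> 1/2\<close> by simp
  qed
  \<comment> \<open>One half comes from closeness of the delay vectors, the other from
    \<open>\<delta>\<close>. An integer of absolute value below 1 vanishes, which determines
    \<open>k\<close>.\<close>
  ultimately have "\<bar>(D j - E j) + of_int k - ?c\<bar> < 1"
    by linarith
  moreover have "(D j - E j) + of_int k - ?c \<in> \<int>"
    by (intro Ints_add Ints_diff Ints_of_int DE)
  ultimately have "D j + of_int k = E j + ?c"
    using Ints_nonzero_abs_less1 by fastforce
  then show ?case
    using step.IH m' by auto
qed

text \<open>If an index were missing, some assigned \<open>i\<close> would be adjacent to an
  unassigned \<open>j\<close>. The integer putting \<open>j\<close> on the same translate of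
  \<open>E\<close> makes the shifts cancel, so a further step would be possible.\<close>

lemma continuation_result_dom:
  assumes res: "continuation_result T D \<delta> N m" and "N > 0"
    and lift: "\<forall>n\<in>dom m. D n + of_int (the (m n)) = E n + (D 0 - E 0)"
    and DE: "\<And>n. D n - E n \<in> \<int>"
    and adjacent: "\<And>A. A \<subseteq> {..<N} \<Longrightarrow> A \<noteq> {} \<Longrightarrow> A \<noteq> {..<N} \<Longrightarrow>
      \<exists>i\<in>A. \<exists>j\<in>{..<N} - A. norm ((T i, E i) - (T j, E j)) < \<delta>"
  shows "dom m = {..<N}"
proof (rule ccontr)
  assume "dom m \<noteq> {..<N}"
  have st: "continuation_state T D \<delta> N m"
    using res by (simp add: continuation_result_def)
  then have "0 \<in> dom m"
    by induction (simp_all add: continuation_step_def dom_def, fastforce)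
  \<comment> \<open>Index 0 is assigned from the start, even for \<open>N = 0\<close>; positivity of
    \<open>N\<close> places it below \<open>N\<close>.\<close>
  moreover have "dom m \<subseteq> {..<N}"
    using continuation_state_dom[OF st] \<open>N > 0\<close> by auto
  ultimately obtain i j where i: "i \<in> dom m" and j: "j \<in> {..<N} - dom m"
    and near: "norm ((T i, E i) - (T j, E j)) < \<delta>"
    using adjacent[of "dom m"] \<open>dom m \<noteq> {..<N}\<close> by blast
  have "(D 0 - E 0) - (D j - E j) \<in> \<int>"
    by (intro Ints_diff DE)
  then obtain k where "(D 0 - E 0) - (D j - E j) = of_int k"
    by (elim Ints_cases)
  then have "D j + of_int k = E j + (D 0 - E 0)"
    by simp
  then have "(T i, D i + of_int (the (m i))) - (T j, D j + of_int k) = (T i, E i) - (T j, E j)"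
    using lift i by simp
  then have "continuation_step T D \<delta> N m (m(j \<mapsto> k))"
    unfolding continuation_step_def using i j near by metis
  then show False
    using res by (auto simp: continuation_result_def)
qed

text \<open>Quantifying over every \<open>m\<close> that is a \<open>continuation_result\<close>
  covers all orders of choices. The total sequence \<open>R\<close> is tied to the averages from
  \<open>N0\<close> on, so its limit is theirs.\<close>

theorem theorem2p1:
  fixes \<rho> :: "real ^ 'd"
    and \<phi> :: "real ^ 'd \<Rightarrow> real"
    and \<psi> :: "real ^ 'd \<Rightarrow> complex"
    and \<Theta> :: "real ^ 'd \<Rightarrow> complex ^ 'k::{finite,linorder}"
    and T :: "nat \<Rightarrow> complex ^ 'k::{finite,linorder}"
    and D :: "nat \<Rightarrow> real"
  defines "\<Theta> \<equiv> delay_map \<rho> \<psi>"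
    and "T \<equiv> \<lambda>n. \<Theta> (trajectory \<rho> n)"
    and "D \<equiv> \<lambda>n. angle_diff \<rho> \<phi> (trajectory \<rho> n)"
  assumes quasi: "quasiperiodic \<rho>"
    and cases_ab:
      "(\<psi> = unit_circle_map \<phi> \<and> torus_smooth \<psi>) \<or>
       (\<exists>P. torus_smooth \<psi> \<and> P \<notin> range \<psi> \<and> is_angle_map \<psi> P \<phi>)"
    and emb: "torus_embedding \<Theta>"
  shows "\<exists>\<delta>0>0. \<forall>\<delta>. 0 < \<delta> \<and> \<delta> < \<delta>0 \<longrightarrow>
    (\<exists>N0. (\<forall>N\<ge>N0. \<forall>m. continuation_result T D \<delta> N m \<longrightarrow> dom m = {..<N}) \<and>
      (\<exists>R. (\<forall>N\<ge>N0. \<forall>m. continuation_result T D \<delta> N m \<longrightarrow>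
               R N = (\<Sum>n<N. D n + of_int (the (m n))) / real N) \<and>
           (\<exists>L. R \<longlonglongrightarrow> L \<and> L - rotation_rate \<rho> \<phi> \<in> \<int>)))"
proof -
  have emb': "torus_smooth \<Theta>" "\<And>x y. \<Theta> x = \<Theta> y \<Longrightarrow> x - y \<in> int_lattice"
    using emb by (auto simp: torus_embedding_def)
  note \<Theta> = torus_smoothD(2,3)[OF emb'(1)]
  \<comment> \<open>Case (a) is an instance of case (b) with \<open>P = 0\<close>: a unit circle map
    omits 0 and is its own normalization.\<close>
  have "torus_smooth \<psi> \<and> (\<exists>P. P \<notin> range \<psi> \<and> is_angle_map \<psi> P \<phi>)"
    using cases_ab
  proof
    assume a: "\<psi> = unit_circle_map \<phi> \<and> torus_smooth \<psi>"
    then have "0 \<notin> range \<psi>" "is_angle_map \<psi> 0 \<phi>"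
      by (auto simp: unit_circle_map_def is_angle_map_def cis_conv_exp mult_ac)
    then show ?thesis
      using a by blast
  qed blast
  then obtain a g where ag: "angle_decomposition \<phi> a g"
    using angle_decomposition_exists by blast
  then have g: "torus_smooth g"
    by (simp add: angle_decomposition_def)
  define u where "u = angle_diff_lift \<rho> a g"
  have u: "continuous_on UNIV u" "lattice_periodic u"
    unfolding u_def by (intro angle_diff_lift_continuous angle_diff_lift_periodic g)+
  define E where "E n = u (trajectory \<rho> n)" for n
  have DE: "D n - E n \<in> \<int>" for n
    unfolding D_def E_def u_def by (rule angle_diff_minus_lift_in_Ints[OF ag])
  \<comment> \<open>The tolerance 1/2 leaves the other half of the unit gap between integer
    translates to \<open>\<delta>\<close>, whence the bound \<open>min d (1/2)\<close>
    below.\<close>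
  obtain d where d: "d > 0" "\<And>x y. norm (\<Theta> x - \<Theta> y) < d \<Longrightarrow> \<bar>u x - u y\<bar> < 1/2"
    using periodic_embedding_separates[OF \<Theta> emb'(2) u, of "1/2"] by auto
  \<comment> \<open>Defining \<open>R\<close> through the lift makes it independent of the choices
    in the continuation and meaningful for every \<open>N\<close>.\<close>
  define R where "R N = (\<Sum>n<N. E n + (D 0 - E 0)) / real N" for N
  have "R \<longlonglongrightarrow> a \<bullet> \<rho> + (D 0 - E 0)"
  proof (rule Lim_transform_eventually)
    show "(\<lambda>N. (\<Sum>n<N. E n) / real N + (D 0 - E 0)) \<longlonglongrightarrow> a \<bullet> \<rho> + (D 0 - E 0)"
      unfolding E_def u_def by (intro tendsto_add tendsto_const angle_diff_lift_average g)
    show "\<forall>\<^sub>F N in sequentially. (\<Sum>n<N. E n) / real N + (D 0 - E 0) = R N"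
      using eventually_gt_at_top[of 0]
      by eventually_elim (simp add: R_def sum.distrib add_divide_distrib)
  qed
  moreover have "a \<bullet> \<rho> + (D 0 - E 0) - rotation_rate \<rho> \<phi> \<in> \<int>"
  proof -
    \<comment> \<open>The limit exceeds the rotation rate by the floor of
      \<open>a \<bullet> \<rho>\<close> plus the integer offset of the translate.\<close>
    have "of_int \<lfloor>a \<bullet> \<rho>\<rfloor> + (D 0 - E 0) \<in> \<int>"
      by (intro Ints_add DE Ints_of_int)
    then show ?thesis
      by (simp only: rotation_rate_eq[OF ag] frac_def) (simp add: algebra_simps)
  qed
  ultimately have L: "\<exists>L. R \<longlonglongrightarrow> L \<and> L - rotation_rate \<rho> \<phi> \<in> \<int>"
    by blast
  show ?thesis
  proof (intro exI[of _ "min d (1/2)"] conjI allI impI)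
    show "min d (1/2) > 0"
      using d(1) by simp
    fix \<delta> :: real
    assume \<delta>: "0 < \<delta> \<and> \<delta> < min d (1/2)"
    \<comment> \<open>Treating \<open>\<Theta>\<close> and \<open>u\<close> as one map controls the
      product norm used by the continuation step directly.\<close>
    have "continuous_on UNIV (\<lambda>\<theta>. (\<Theta> \<theta>, u \<theta>))"
      by (intro continuous_on_Pair \<Theta> u)
    moreover have "lattice_periodic (\<lambda>\<theta>. (\<Theta> \<theta>, u \<theta>))"
      using \<Theta>(2) u(2) by (simp add: lattice_periodic_def)
    ultimately obtain \<eta> where \<eta>: "\<eta> > 0"
      "\<And>x y. dist x y < \<eta> \<Longrightarrow> dist (\<Theta> x, u x) (\<Theta> y, u y) < \<delta>"
      using periodic_uniformly_continuous[of "\<lambda>\<theta>. (\<Theta> \<theta>, u \<theta>)" \<delta>] \<delta> by blast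
    \<comment> \<open>Adjacent net points may be twice the net radius apart, so the radius is half
      of \<open>\<eta>\<close>.\<close>
    obtain N0 where N0: "N0 > 0"
      "\<And>x. \<exists>n<N0. \<exists>k\<in>int_lattice. dist (trajectory \<rho> n + k) x < \<eta> / 2"
      using trajectory_net[OF quasi, of "\<eta> / 2"] \<eta>(1) by auto
    have lift: "\<forall>n\<in>dom m. D n + of_int (the (m n)) = E n + (D 0 - E 0)"
      if "continuation_result T D \<delta> N m" for N m
    proof (rule continuation_state_follows_lift[OF _ _ DE])
      show "continuation_state T D \<delta> N m"
        using that by (simp add: continuation_result_def)
      show "\<bar>E i - E j\<bar> < 1/2" if "norm (T i - T j) < \<delta>" for i j
        using that \<delta> unfolding E_def T_def by (intro d(2)) simp
    qed (use \<delta> in simp)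
    have dom: "dom m = {..<N}" if "N \<ge> N0" "continuation_result T D \<delta> N m" for N m
    proof (rule continuation_result_dom[OF that(2) _ lift[OF that(2)] DE])
      fix A
      assume A: "A \<subseteq> {..<N}" "A \<noteq> {}" "A \<noteq> {..<N}"
      have "\<exists>n<N. \<exists>k\<in>int_lattice. dist (trajectory \<rho> n + k) x < \<eta> / 2" for x
        using N0(2) that(1) by (meson order_less_le_trans)
      from net_adjacent[OF this A] \<eta>(1) obtain i j k where ij: "i \<in> A" "j \<in> {..<N} - A"
        and k: "k \<in> int_lattice" "dist (trajectory \<rho> i) (trajectory \<rho> j + k) < \<eta>"
        by auto
      have "\<Theta> (trajectory \<rho> j + k) = T j" "u (trajectory \<rho> j + k) = E j"
        using \<Theta>(2) u(2) k(1) by (simp_all add: lattice_periodic_def T_def E_def)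
      then have "norm ((T i, E i) - (T j, E j)) < \<delta>"
        using \<eta>(2)[OF k(2)] by (simp add: dist_norm T_def E_def)
      then show "\<exists>i\<in>A. \<exists>j\<in>{..<N} - A. norm ((T i, E i) - (T j, E j)) < \<delta>"
        using ij by blast
    qed (use N0(1) that(1) in simp)
    have "R N = (\<Sum>n<N. D n + of_int (the (m n))) / real N"
      if "N \<ge> N0" "continuation_result T D \<delta> N m" for N m
      unfolding R_def using lift[OF that(2)] dom[OF that] by simp
    then show "\<exists>N0. (\<forall>N\<ge>N0. \<forall>m. continuation_result T D \<delta> N m \<longrightarrow> dom m = {..<N}) \<and>
        (\<exists>R. (\<forall>N\<ge>N0. \<forall>m. continuation_result T D \<delta> N m \<longrightarrow>
                 R N = (\<Sum>n<N. D n + of_int (the (m n))) / real N) \<and>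
             (\<exists>L. R \<longlonglongrightarrow> L \<and> L - rotation_rate \<rho> \<phi> \<in> \<int>))"
      using dom L by blast
  qed
qed

end
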